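(* Let $\pi:\mathbb{N}\to\mathbb{N}$ be a permutation of the positive integers. Then $\pi$ belongs to the Lévy group $\mathcal{G}$ if and only if the sequence $\left(\frac{\pi(n)}{n}\right)_{n\ge 1}$ converges statistically to $1$.
   Context: $\mathbb{N}=\{1,2,3,\dots\}$. For $A\subseteq\mathbb{N}$ let $A(n)=|A\cap[1,n]|$; the asymptotic density of $A$ is $d(A)=\lim_{n\to\infty}A(n)/n$ when this limit exists. The Lévy group $\mathcal{G}$ is the group of all permutations $\pi$ of $\mathbb{N}$ such that $\lim_{n\to\infty}\frac{|\{k:\ k\le n<\pi(k)\}|}{n}=0$. A real sequence $(x_n)$ converges statistically to $L$ if for every $\varepsilon>0$ the set $\{n:\ |x_n-L|\ge\varepsilon\}$ has asymptotic density $0$. *)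

theory Defs
  imports "HOL-Analysis.Analysis" "HOL-Combinatorics.Permutations"
begin

text \<open>The positive integers are the subset \<open>{1..}\<close> of \<open>nat\<close>. Sequences indexed by the positive
  integers are functions on \<open>nat\<close> whose value at \<open>0\<close> is irrelevant, and the quotients by
  \<open>n = 0\<close> below do not affect the limits.\<close>

definition counting :: "nat set \<Rightarrow> nat \<Rightarrow> nat" where
  "counting A n = card (A \<inter> {1..n})"

definition has_asymptotic_density :: "nat set \<Rightarrow> real \<Rightarrow> bool" where
  "has_asymptotic_density A d \<longleftrightarrow> (\<lambda>n. real (counting A n) / real n) \<longlonglongrightarrow> d"

definition converges_statistically :: "(nat \<Rightarrow> real) \<Rightarrow> real \<Rightarrow> bool" where
  "converges_statistically x L \<longleftrightarrow>
     (\<forall>\<epsilon>>0. has_asymptotic_density {n \<in> {1..}. \<bar>x n - L\<bar> \<ge> \<epsilon>} 0)"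

text \<open>A permutation of the positive integers is represented by its unique extension to \<open>nat\<close>
  that fixes \<open>0\<close>.\<close>

definition levy_group :: "(nat \<Rightarrow> nat) set" where
  "levy_group = {\<pi>. \<pi> permutes {1..} \<and>
     (\<lambda>n. real (card {k \<in> {1..}. k \<le> n \<and> n < \<pi> k}) / real n) \<longlonglongrightarrow> 0}"

end

theory Submission
  imports Defs
begin

text \<open>Write \<open>g n\<close> for the number of \<open>k \<le> n\<close> with \<open>\<pi> k > n\<close>; since \<open>\<pi>\<close> is a bijection, as many
  \<open>k > n\<close> satisfy \<open>\<pi> k \<le> n\<close>. If \<open>k \<le> n < \<pi> k\<close>, then either \<open>\<pi> k \<ge> (1 + \<epsilon>) k\<close> or
  \<open>n / (1 + \<epsilon>) < k \<le> n\<close>, so \<open>g\<close> is controlled by the exceptional sets of statistical convergence.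
  Conversely let \<open>A\<close> be the set of \<open>k\<close> with \<open>\<bar>\<pi> k / k - 1\<bar> \<ge> \<epsilon>\<close>, let \<open>q = 1 + \<epsilon>\<close> and
  \<open>m = \<lfloor>n / q\<rfloor>\<close>. Each \<open>k \<in> A\<close> with \<open>m < k \<le> n\<close> has \<open>\<pi> k > n\<close> or \<open>\<pi> k \<le> m\<close>, so
  \<open>A(n) \<le> A(m) + g(n) + g(m)\<close>; iterating this contraction gives \<open>A(n) = o(n)\<close>.\<close>

definition crossings :: "(nat \<Rightarrow> nat) \<Rightarrow> nat \<Rightarrow> nat set" where
  "crossings \<pi> n = {k \<in> {1..}. k \<le> n \<and> n < \<pi> k}"

lemma finite_crossings [simp]: "finite (crossings \<pi> n)"
  by (rule finite_subset[of _ "{1..n}"]) (auto simp: crossings_def)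

text \<open>The preimage \<open>P\<close> of \<open>{1..n}\<close> has \<open>n\<close> elements,
  just as \<open>{1..n}\<close> has. Deleting the common part from both leaves two sets of equal
  size: what remains of \<open>P\<close> crosses \<open>n\<close> downwards, what remains of
  \<open>{1..n}\<close> crosses it upwards.\<close>

lemma card_down_crossings:
  assumes "\<pi> permutes {1..}"
  shows "finite {k. n < k \<and> \<pi> k \<le> n}"
    and "card {k. n < k \<and> \<pi> k \<le> n} = card (crossings \<pi> n)"
proof -
  define P where "P = inv \<pi> ` {1..n}"
  have bij: "bij \<pi>"
    using assms by (rule permutes_bij)
  have pos: "\<pi> k \<ge> 1 \<longleftrightarrow> k \<ge> 1" for k
    using permutes_in_image[OF assms, of k] by (simp only: atLeast_iff)
  have P: "P = {k. 1 \<le> k \<and> \<pi> k \<le> n}"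
  proof -
    have "P = \<pi> -` {1..n}"
      unfolding P_def using bij by (simp add: bij_vimage_eq_inv_image)
    also have "\<dots> = {k. 1 \<le> k \<and> \<pi> k \<le> n}"
      using pos unfolding vimage_def atLeastAtMost_iff by blast
    finally show ?thesis .
  qed
  have fin: "finite P"
    by (simp add: P_def)
  have "card P = n"
    using inj_on_subset[OF bij_is_inj[OF bij_imp_bij_inv[OF bij]]]
    by (simp add: P_def card_image)
  moreover have "card P = card (P \<inter> {1..n}) + card (P - {1..n})"
    using fin by (rule card_Int_Diff)
  moreover have "n = card ({1..n} \<inter> P) + card ({1..n} - P)"
    using card_Int_Diff[of "{1..n}" P] by simp
  ultimately have "card (P - {1..n}) = card ({1..n} - P)"
    by (simp add: Int_commute)
  moreover have down: "P - {1..n} = {k. n < k \<and> \<pi> k \<le> n}"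
    unfolding P by auto
  moreover have "{1..n} - P = crossings \<pi> n"
    unfolding P crossings_def by auto
  ultimately show "card {k. n < k \<and> \<pi> k \<le> n} = card (crossings \<pi> n)"
    by simp
  show "finite {k. n < k \<and> \<pi> k \<le> n}"
    using fin down by (metis finite_Diff)
qed

text \<open>A bound of arbitrarily small slope for all \<open>n\<close>, with the small
  \<open>n\<close> absorbed by \<open>C\<close>, is easier to prove by induction than an eventual
  bound. Half of \<open>r\<close> is the slope; the other half outgrows \<open>C\<close>.\<close>

lemma LIMSEQ_divide_zeroI:
  fixes f :: "nat \<Rightarrow> real"
  assumes nonneg: "\<And>n. f n \<ge> 0"
    and bound: "\<And>\<delta>. \<delta> > 0 \<Longrightarrow> \<exists>C. \<forall>n. f n \<le> \<delta> * real n + C"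
  shows "(\<lambda>n. f n / real n) \<longlonglongrightarrow> 0"
proof (rule LIMSEQ_I)
  fix r :: real
  assume r: "r > 0"
  obtain C where C: "\<And>n. f n \<le> r / 2 * real n + C"
    using bound[of "r / 2"] r by auto
  obtain N :: nat where N: "real N > 2 * C / r"
    using reals_Archimedean2 by blast
  have "norm (f n / real n - 0) < r" if "n \<ge> max N 1" for n
  proof -
    have "real n > 2 * C / r" and "n > 0"
      using that N by auto
    then have "C < r / 2 * real n"
      using r by (simp add: field_simps)
    then have "f n < r * real n"
      using C[of n] by (simp add: algebra_simps)
    then show ?thesis
      using \<open>n > 0\<close> nonneg[of n] by (simp add: field_simps)
  qed
  then show "\<exists>N. \<forall>n\<ge>N. norm (f n / real n - 0) < r"
    by blast
qed

lemma LIMSEQ_divide_zeroD: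
  fixes f :: "nat \<Rightarrow> real"
  assumes "(\<lambda>n. f n / real n) \<longlonglongrightarrow> 0" and "\<delta> > 0"
  obtains N where "\<And>n. n \<ge> N \<Longrightarrow> f n \<le> \<delta> * real n" "N > 0"
proof -
  obtain N where N: "\<And>n. n \<ge> N \<Longrightarrow> norm (f n / real n - 0) < \<delta>"
    using LIMSEQ_D[OF assms] by blast
  have "f n \<le> \<delta> * real n" if "n \<ge> max N 1" for n
  proof -
    have "f n / real n < \<delta>"
      using N[of n] that by (simp only: real_norm_def diff_0_right) linarith
    then show ?thesis
      using that by (simp add: field_simps)
  qed
  then show ?thesis
    using that[of "max N 1"] by auto
qed

lemma nat_floor_divide:
  fixes q :: real
  assumes "q > 1"
  shows "real (nat \<lfloor>real n / q\<rfloor>) \<le> real n / q"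
    and "real n / q < real (nat \<lfloor>real n / q\<rfloor>) + 1"
    and "nat \<lfloor>real n / q\<rfloor> \<le> n"
    and "n > 0 \<Longrightarrow> nat \<lfloor>real n / q\<rfloor> < n"
proof -
  show le: "real (nat \<lfloor>real n / q\<rfloor>) \<le> real n / q"
    and "real n / q < real (nat \<lfloor>real n / q\<rfloor>) + 1"
    using assms by (auto simp: of_nat_nat)
  show less: "nat \<lfloor>real n / q\<rfloor> < n" if "n > 0"
  proof -
    have "real n / q < real n"
      using that assms by (simp add: field_simps)
    with le show ?thesis
      by linarith
  qed
  show "nat \<lfloor>real n / q\<rfloor> \<le> n"
    using less by (cases "n = 0") auto
qed

text \<open>Passing from \<open>n\<close> to about \<open>n / q\<close> shrinks a linear bound by
  the factor \<open>1 / q\<close>, which leaves room for the sublinear error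
  \<open>e\<close>.\<close>

lemma LIMSEQ_divide_zero_recurrence:
  fixes f e :: "nat \<Rightarrow> real" and q :: real
  assumes q: "q > 1"
    and nonneg: "\<And>n. f n \<ge> 0"
    and rec: "\<And>n. f n \<le> f (nat \<lfloor>real n / q\<rfloor>) + e n"
    and e: "(\<lambda>n. e n / real n) \<longlonglongrightarrow> 0"
  shows "(\<lambda>n. f n / real n) \<longlonglongrightarrow> 0"
proof (rule LIMSEQ_divide_zeroI)
  fix \<delta> :: real
  assume \<delta>: "\<delta> > 0"
  \<comment> \<open>This is exactly the slope that \<open>e\<close> may use:
    \<open>\<delta> / q\<close> from the induction hypothesis plus
    \<open>\<delta> * (1 - 1 / q)\<close> restores \<open>\<delta>\<close>.\<close>
  have "\<delta> * (1 - 1 / q) > 0"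
    using \<delta> q by simp
  then obtain N where N: "\<And>n. n \<ge> N \<Longrightarrow> e n \<le> \<delta> * (1 - 1 / q) * real n" "N > 0"
    using LIMSEQ_divide_zeroD[OF e] by blast
  \<comment> \<open>As the values of \<open>f\<close> are nonnegative, this sum dominates each
    \<open>f n\<close> with \<open>n < N\<close>.\<close>
  define C where "C = (\<Sum>n<N. f n)"
  have "f n \<le> \<delta> * real n + C" for n
  proof (induction n rule: less_induct)
    case (less n)
    show ?case
    proof (cases "n < N")
      case True
      then have "f n \<le> C"
        unfolding C_def using nonneg by (intro member_le_sum) auto
      with \<delta> show ?thesis
        by (simp add: add_increasing)
    next
      case False
      let ?m = "nat \<lfloor>real n / q\<rfloor>"
      \<comment> \<open>\<open>N > 0\<close> forces \<open>n > 0\<close> here, so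
        \<open>?m < n\<close> and the induction hypothesis applies.\<close>
      have "f ?m \<le> \<delta> * real ?m + C"
        using False N(2) nat_floor_divide(4)[OF q, of n] by (intro less.IH) auto
      also have "\<dots> \<le> \<delta> * (real n / q) + C"
        using nat_floor_divide(1)[OF q] \<delta> by (intro add_right_mono mult_left_mono) auto
      finally have "f n \<le> \<delta> * (real n / q) + C + \<delta> * (1 - 1 / q) * real n"
        using rec[of n] N(1)[of n] False by linarith
      also have "\<dots> = \<delta> * real n + C"
        by (simp add: algebra_simps)
      finally show ?thesis .
    qed
  qed
  then show "\<exists>C. \<forall>n. f n \<le> \<delta> * real n + C"
    by blast
qed (rule nonneg)

lemma counting_exceptional_recurrence:
  fixes \<epsilon> :: real
  assumes perm: "\<pi> permutes {1..}" and \<epsilon>: "\<epsilon> > 0"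
  defines "A \<equiv> {k \<in> {1..}. \<bar>real (\<pi> k) / real k - 1\<bar> \<ge> \<epsilon>}"
  shows "counting A n \<le> counting A (nat \<lfloor>real n / (1 + \<epsilon>)\<rfloor>)
    + (card (crossings \<pi> n) + card (crossings \<pi> (nat \<lfloor>real n / (1 + \<epsilon>)\<rfloor>)))"
proof -
  define m where "m = nat \<lfloor>real n / (1 + \<epsilon>)\<rfloor>"
  let ?H = "{k. m < k \<and> \<pi> k \<le> m}"
  have q: "1 + \<epsilon> > 1"
    using \<epsilon> by simp
  note m = nat_floor_divide[OF q, of n, folded m_def]
  have "A \<inter> {1..n} \<subseteq> A \<inter> {1..m} \<union> (crossings \<pi> n \<union> ?H)"
  proof
    fix k
    assume k: "k \<in> A \<inter> {1..n}"
    show "k \<in> A \<inter> {1..m} \<union> (crossings \<pi> n \<union> ?H)"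
    proof (cases "k \<le> m")
      case True
      with k show ?thesis
        by auto
    next
      case False
      \<comment> \<open>Now \<open>k\<close> is at least \<open>m + 1\<close>, which exceeds
        \<open>n / (1 + \<epsilon>)\<close>; growth by the factor \<open>1 + \<epsilon>\<close>
        therefore carries it past \<open>n\<close>.\<close>
      then have "real n / (1 + \<epsilon>) < real k"
        using m(2) by linarith
      then have nk: "real n < (1 + \<epsilon>) * real k"
        using \<epsilon> by (simp add: field_simps)
      have kpos: "real k > 0" and kn: "real k \<le> real n"
        using k by auto
      have "real (\<pi> k) / real k \<ge> 1 + \<epsilon> \<or> real (\<pi> k) / real k \<le> 1 - \<epsilon>"
        using k by (auto simp: A_def abs_if split: if_splits)
      then show ?thesis
      proof
        assume "real (\<pi> k) / real k \<ge> 1 + \<epsilon>"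
        then have "(1 + \<epsilon>) * real k \<le> real (\<pi> k)"
          using kpos by (simp add: field_simps)
        then have "n < \<pi> k"
          using nk by linarith
        with k show ?thesis
          by (auto simp: crossings_def)
      next
        assume "real (\<pi> k) / real k \<le> 1 - \<epsilon>"
        then have "real (\<pi> k) \<le> (1 - \<epsilon>) * real k"
          using kpos by (simp add: field_simps)
        \<comment> \<open>The ratio \<open>1 + \<epsilon>\<close> serves downward jumps too, because
          \<open>(1 + \<epsilon>) * (1 - \<epsilon>) \<le> 1\<close>: a point
          \<open>k \<le> n\<close> lands at or below \<open>n / (1 + \<epsilon>)\<close>. No case
          split on \<open>\<epsilon> \<ge> 1\<close> arises.\<close>
        then have "(1 + \<epsilon>) * real (\<pi> k) \<le> (1 + \<epsilon>) * ((1 - \<epsilon>) * real k)"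
          using \<epsilon> by (intro mult_left_mono) auto
        also have "\<dots> = real k - \<epsilon>\<^sup>2 * real k"
          by (simp add: algebra_simps power2_eq_square)
        also have "\<dots> \<le> real n"
          using kn by (intro order.trans[OF _ kn]) simp
        finally have "real (\<pi> k) \<le> real n / (1 + \<epsilon>)"
          using \<epsilon> by (simp add: field_simps)
        then have "\<pi> k \<le> m"
          unfolding m_def by (simp add: le_nat_floor)
        with False show ?thesis
          by auto
      qed
    qed
  qed
  then have "counting A n \<le> card (A \<inter> {1..m} \<union> (crossings \<pi> n \<union> ?H))"
    unfolding counting_def by (rule card_mono[rotated]) (simp add: card_down_crossings[OF perm])
  also have "\<dots> \<le> card (A \<inter> {1..m}) + card (crossings \<pi> n \<union> ?H)"
    by (rule card_Un_le)
  also have "\<dots> \<le> card (A \<inter> {1..m}) + (card (crossings \<pi> n) + card ?H)"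
    by (intro add_left_mono card_Un_le)
  finally show ?thesis
    by (simp add: counting_def card_down_crossings[OF perm] m_def)
qed

text \<open>A crossing point outside the exceptional set grows by less than the factor
  \<open>1 + \<epsilon>\<close>, so it lies in the short window from
  \<open>n / (1 + \<epsilon>)\<close> to \<open>n\<close>.\<close>

lemma card_crossings_le:
  fixes \<epsilon> :: real
  assumes \<epsilon>: "\<epsilon> > 0"
  shows "real (card (crossings \<pi> n))
    \<le> real (counting {k \<in> {1..}. \<bar>real (\<pi> k) / real k - 1\<bar> \<ge> \<epsilon>} n) + (\<epsilon> * real n + 1)"
proof -
  let ?A = "{k \<in> {1..}. \<bar>real (\<pi> k) / real k - 1\<bar> \<ge> \<epsilon>}"
  define m where "m = nat \<lfloor>real n / (1 + \<epsilon>)\<rfloor>"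
  have q: "1 + \<epsilon> > 1"
    using \<epsilon> by simp
  note m = nat_floor_divide[OF q, of n, folded m_def]
  have "crossings \<pi> n \<subseteq> (?A \<inter> {1..n}) \<union> {m<..n}"
  proof
    fix k
    assume "k \<in> crossings \<pi> n"
    then have k: "1 \<le> k" "k \<le> n" "n < \<pi> k"
      by (auto simp: crossings_def)
    show "k \<in> (?A \<inter> {1..n}) \<union> {m<..n}"
    proof (cases "k \<in> ?A")
      case False
      then have "real (\<pi> k) / real k < 1 + \<epsilon>"
        using k by (auto simp: abs_if split: if_splits)
      then have "real (\<pi> k) < (1 + \<epsilon>) * real k"
        using k by (simp add: field_simps)
      then have "real n < (1 + \<epsilon>) * real k"
        using k by linarith
      then have "real n / (1 + \<epsilon>) < real k"
        using \<epsilon> by (simp add: field_simps)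
      then have "m < k"
        using m(1) by linarith
      with k show ?thesis
        by simp
    qed (use k in auto)
  qed
  then have "card (crossings \<pi> n) \<le> card ((?A \<inter> {1..n}) \<union> {m<..n})"
    by (rule card_mono[rotated]) simp
  also have "\<dots> \<le> card (?A \<inter> {1..n}) + card {m<..n}"
    by (rule card_Un_le)
  finally have "real (card (crossings \<pi> n)) \<le> real (counting ?A n) + (real n - real m)"
    using m(3) by (simp add: counting_def)
  moreover have "real n - real m \<le> \<epsilon> * real n + 1"
  proof -
    \<comment> \<open>The window has length at most \<open>\<epsilon> * n\<close>; the extra 1 in
      the bound pays for rounding \<open>m\<close> down.\<close>
    have "(1 - \<epsilon>) * real n \<le> real n / (1 + \<epsilon>)"
    proof -
      have "(1 - \<epsilon>) * real n * (1 + \<epsilon>) = real n - \<epsilon>\<^sup>2 * real n"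
        by (simp add: algebra_simps power2_eq_square)
      also have "\<dots> \<le> real n"
        by simp
      finally show ?thesis
        using \<epsilon> by (simp add: pos_le_divide_eq)
    qed
    with m(2) show ?thesis
      by (simp add: algebra_simps)
  qed
  ultimately show ?thesis
    by linarith
qed

theorem theorem2p2:
  fixes \<pi> :: "nat \<Rightarrow> nat"
  assumes "\<pi> permutes {1..}"
  shows "\<pi> \<in> levy_group \<longleftrightarrow> converges_statistically (\<lambda>n. real (\<pi> n) / real n) 1"
proof -
  define g where "g n = real (card (crossings \<pi> n))" for n
  define A where "A \<epsilon> = {k \<in> {1..}. \<bar>real (\<pi> k) / real k - 1\<bar> \<ge> \<epsilon>}" for \<epsilon> :: real
  have levy: "\<pi> \<in> levy_group \<longleftrightarrow> (\<lambda>n. g n / real n) \<longlonglongrightarrow> 0"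
    using assms by (simp add: levy_group_def g_def crossings_def)
  have stat: "converges_statistically (\<lambda>n. real (\<pi> n) / real n) 1
      \<longleftrightarrow> (\<forall>\<epsilon>>0. (\<lambda>n. real (counting (A \<epsilon>) n) / real n) \<longlonglongrightarrow> 0)"
    by (simp add: converges_statistically_def has_asymptotic_density_def A_def)
  show ?thesis
    unfolding levy stat
  proof (intro iffI allI impI)
    fix \<epsilon> :: real
    assume g: "(\<lambda>n. g n / real n) \<longlonglongrightarrow> 0" and \<epsilon>: "\<epsilon> > 0"
    define m where "m n = nat \<lfloor>real n / (1 + \<epsilon>)\<rfloor>" for n
    have q: "1 + \<epsilon> > 1"
      using \<epsilon> by simp
    \<comment> \<open>Smallness of \<open>g\<close> at \<open>m n\<close> transfers to the scale
      \<open>n\<close> since \<open>m n \<le> n\<close>; the finite sum covers the case where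
      \<open>m n\<close> is still below the threshold \<open>N\<close>.\<close>
    have gm: "(\<lambda>n. g (m n) / real n) \<longlonglongrightarrow> 0"
    proof (rule LIMSEQ_divide_zeroI)
      fix \<delta> :: real
      assume \<delta>: "\<delta> > 0"
      obtain N where N: "\<And>n. n \<ge> N \<Longrightarrow> g n \<le> \<delta> * real n"
        using LIMSEQ_divide_zeroD[OF g \<delta>] by blast
      have "g (m n) \<le> \<delta> * real n + (\<Sum>k<N. g k)" for n
      proof (cases "m n < N")
        case True
        then have "g (m n) \<le> (\<Sum>k<N. g k)"
          by (intro member_le_sum) (auto simp: g_def)
        with \<delta> show ?thesis
          by (simp add: add_increasing)
      next
        case False
        then have "g (m n) \<le> \<delta> * real (m n)"
          by (intro N) simp
        also have "\<dots> \<le> \<delta> * real n"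
          using nat_floor_divide(3)[OF q, of n] \<delta> by (simp add: m_def)
        moreover have "(\<Sum>k<N. g k) \<ge> 0"
          by (intro sum_nonneg) (simp add: g_def)
        ultimately show ?thesis
          by linarith
      qed
      then show "\<exists>C. \<forall>n. g (m n) \<le> \<delta> * real n + C"
        by blast
    qed (simp add: g_def)
    show "(\<lambda>n. real (counting (A \<epsilon>) n) / real n) \<longlonglongrightarrow> 0"
    proof (rule LIMSEQ_divide_zero_recurrence[OF q])
      show "real (counting (A \<epsilon>) n)
          \<le> real (counting (A \<epsilon>) (nat \<lfloor>real n / (1 + \<epsilon>)\<rfloor>)) + (g n + g (m n))" for n
        using counting_exceptional_recurrence[OF assms \<epsilon>, of n]
        unfolding A_def g_def m_def by linarith
      show "(\<lambda>n. (g n + g (m n)) / real n) \<longlonglongrightarrow> 0"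
        using tendsto_add[OF g gm] by (simp add: add_divide_distrib)
    qed simp
  next
    assume A: "\<forall>\<epsilon>>0. (\<lambda>n. real (counting (A \<epsilon>) n) / real n) \<longlonglongrightarrow> 0"
    show "(\<lambda>n. g n / real n) \<longlonglongrightarrow> 0"
    proof (rule LIMSEQ_divide_zeroI)
      fix \<delta> :: real
      assume \<delta>: "\<delta> > 0"
      \<comment> \<open>One half of \<open>\<delta>\<close> bounds the density of the exceptional
        set, the other is its tolerance and hence the relative length of the window.\<close>
      then have \<delta>2: "\<delta> / 2 > 0"
        by simp
      obtain N where N: "\<And>n. n \<ge> N \<Longrightarrow> real (counting (A (\<delta> / 2)) n) \<le> \<delta> / 2 * real n"
        using LIMSEQ_divide_zeroD[OF A[rule_format, OF \<delta>2] \<delta>2] by blast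
      \<comment> \<open>The constant \<open>N\<close> covers \<open>n < N\<close>, where the count
        is at most \<open>n\<close>; the 1 is the rounding term of
        \<open>card_crossings_le\<close>.\<close>
      have "g n \<le> \<delta> * real n + (real N + 1)" for n
      proof -
        have "real (counting (A (\<delta> / 2)) n) \<le> \<delta> / 2 * real n + real N"
        proof (cases "n \<ge> N")
          case True
          then show ?thesis
            using N[of n] by simp
        next
          case False
          have "counting (A (\<delta> / 2)) n \<le> card {1..n}"
            unfolding counting_def by (intro card_mono) auto
          then have "real (counting (A (\<delta> / 2)) n) \<le> real N"
            using False by simp
          with \<delta> show ?thesis
            by (simp add: add_increasing)
        qed
        then show ?thesis
          using card_crossings_le[OF \<delta>2, of \<pi> n, folded A_def g_def] by simp
      qed
      then show "\<exists>C. \<forall>n. g n \<le> \<delta> * real n + C"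
        by blast
    qed (simp add: g_def)
  qed
qed

end
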